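(* For every fixed integer $r>0$ there are infinitely many numerical semigroups of maximal reduced type with type $r$; that is, infinitely many numerical semigroups $S$ with $\mathrm{type}(k[[S]])=r$ such that $k[[S]]$ has maximal reduced type.
   Context: $\mathbb{N}$ denotes the non-negative integers. A numerical semigroup is a submonoid $S$ of $(\mathbb{N},+)$ with $\mathbb{N}\setminus S$ finite. The multiplicity $m(S)$ is the smallest nonzero element of $S$, and the Frobenius number $\mathrm{F}(S)$ is the largest integer not in $S$. A pseudo-Frobenius number of $S$ is an integer $f\notin S$ with $f+s\in S$ for all $s\in S\setminus\{0\}$; $\mathrm{PF}(S)$ is the set of these. Let $k$ be an algebraically closed field of characteristic zero. For $S$ with minimal generators $n_1,\ldots,n_e$, $R=k[[S]] := k[[t^{n_1},\ldots,t^{n_e}]]\subseteq k[[t]]$. The type, $\mathrm{type}(k[[S]])$, is the Cohen-Macaulay type of $k[[S]]$, which equals $|\mathrm{PF}(S)|$. With $K$ the quotient field of $R$, $\bar R$ its integral closure in $K$ and $\mathfrak{C}=(R:_K\bar R)$ the conductor ideal, the reduced type is $s(R)=\dim_k \frac{\mathfrak{C}+xR}{xR}$ with $x=t^{m(S)}$; it satisfies $1\le s(R)\le \mathrm{type}(R)$, and it is known to equal the number of integers in $[\mathrm{F}(S)-m(S)+1,\mathrm{F}(S)]\setminus S$. $R$ (or $S$) has maximal reduced type if $s(R)=\mathrm{type}(R)$. *)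

theory Defs
  imports
    "HOL-Computational_Algebra.Formal_Laurent_Series"
    "HOL-Library.Multiset"
begin

subsection \<open>Numerical semigroups\<close>

definition numerical_semigroup :: "nat set \<Rightarrow> bool" where
  "numerical_semigroup S \<longleftrightarrow>
     0 \<in> S \<and> (\<forall>a\<in>S. \<forall>b\<in>S. a + b \<in> S) \<and> finite (UNIV - S)"

definition sg_multiplicity :: "nat set \<Rightarrow> nat" where
  "sg_multiplicity S = (LEAST n. n \<in> S \<and> n \<noteq> 0)"

definition minimal_generators :: "nat set \<Rightarrow> nat set" where
  "minimal_generators S =
     {n \<in> S - {0}. \<not> (\<exists>a\<in>S - {0}. \<exists>b\<in>S - {0}. n = a + b)}"


subsection \<open>The ring \<open>k[[S]]\<close>\<close>

text \<open>
  All rings live inside the field \<open>k((t))\<close> of formal Laurent series.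
  A monomial in variables indexed by the minimal generators \<open>n\<^sub>1, \<dots>, n\<^sub>e\<close> is a finite
  multiset \<open>A\<close> of minimal generators; substituting \<open>t\<^sup>n\<close> for the variable of index \<open>n\<close>
  turns it into \<open>t\<close> to the power \<open>\<Sum>\<^sub># A\<close>.  A power series in these variables is a
  coefficient function \<open>c\<close> on monomials, and \<open>k[[S]]\<close> is the set of values of all such
  power series.  For each \<open>n\<close> the sum below is over a finite set, because the minimal
  generators are positive.
\<close>

definition semigroup_ring :: "nat set \<Rightarrow> 'k::field fls set" where
  "semigroup_ring S =
     {fps_to_fls (Abs_fps (\<lambda>n. \<Sum>A | set_mset A \<subseteq> minimal_generators S \<and> \<Sum>\<^sub># A = n. c A))
        | c :: nat multiset \<Rightarrow> 'k. True}"


subsection \<open>Dimension of a quotient space\<close>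

text \<open>
  \<open>basis_mod W V B\<close>: the classes of the elements of the finite set \<open>B\<close> are distinct
  and form a \<open>k\<close>-basis of \<open>V / W\<close>.
\<close>

definition basis_mod :: "'k::field fls set \<Rightarrow> 'k fls set \<Rightarrow> 'k fls set \<Rightarrow> bool" where
  "basis_mod W V B \<longleftrightarrow>
     finite B \<and> B \<subseteq> V \<and>
     (\<forall>c. (\<Sum>b\<in>B. fls_const (c b) * b) \<in> W \<longrightarrow> (\<forall>b\<in>B. c b = 0)) \<and>
     (\<forall>v\<in>V. \<exists>c. v - (\<Sum>b\<in>B. fls_const (c b) * b) \<in> W)"

definition quotient_dim :: "'k::field fls set \<Rightarrow> 'k fls set \<Rightarrow> nat" where
  "quotient_dim V W = (THE n. \<exists>B. basis_mod W V B \<and> card B = n)"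


subsection \<open>Ring-theoretic invariants of a subring \<open>R\<close> of \<open>k((t))\<close>\<close>

definition quotient_field :: "'k::field fls set \<Rightarrow> 'k fls set" where
  "quotient_field R = {a / b | a b. a \<in> R \<and> b \<in> R \<and> b \<noteq> 0}"

definition integral_closure :: "'k::field fls set \<Rightarrow> 'k fls set" where
  "integral_closure R =
     {z \<in> quotient_field R.
        \<exists>p :: 'k fls poly. lead_coeff p = 1 \<and> (\<forall>i. coeff p i \<in> R) \<and> poly p z = 0}"

definition conductor :: "'k::field fls set \<Rightarrow> 'k fls set" where
  "conductor R = {z \<in> quotient_field R. \<forall>y\<in>integral_closure R. z * y \<in> R}"

definition nonunits :: "'k::field fls set \<Rightarrow> 'k fls set" where
  "nonunits R = {a \<in> R. \<not> (\<exists>b\<in>R. a * b = 1)}"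

definition principal_ideal :: "'k::field fls set \<Rightarrow> 'k fls \<Rightarrow> 'k fls set" where
  "principal_ideal R x = {x * a | a. a \<in> R}"

text \<open>The preimage in \<open>R\<close> of the socle of \<open>R / xR\<close>, where \<open>R\<close> is local.\<close>

definition socle_preimage :: "'k::field fls set \<Rightarrow> 'k fls \<Rightarrow> 'k fls set" where
  "socle_preimage R x = {a \<in> R. \<forall>y\<in>nonunits R. a * y \<in> principal_ideal R x}"

text \<open>
  The Cohen--Macaulay type of a one-dimensional Cohen--Macaulay local ring is the
  dimension, over the residue field, of the socle of \<open>R / xR\<close> for a regular parameter
  \<open>x\<close>, i.e. for a domain any nonzero nonunit.  It does not depend on \<open>x\<close>, see
  \<open>cm_type_parameter_independent\<close>.  The residue field of \<open>k[[S]]\<close> is \<open>k\<close>.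
\<close>

definition cm_type :: "'k::field fls set \<Rightarrow> 'k fls \<Rightarrow> nat" where
  "cm_type R x = quotient_dim (socle_preimage R x) (principal_ideal R x)"

definition reduced_type :: "'k::field fls set \<Rightarrow> 'k fls \<Rightarrow> nat" where
  "reduced_type R x =
     quotient_dim {z + y | z y. z \<in> conductor R \<and> y \<in> principal_ideal R x}
       (principal_ideal R x)"

lemma basis_mod_mult:
  fixes h :: "'k::field fls"
  assumes h: "h \<noteq> 0" and B: "basis_mod W V B"
  shows "basis_mod ((*) h ` W) ((*) h ` V) ((*) h ` B)"
proof -
  have inj: "inj_on ((*) h) A" for A using h by (auto simp: inj_on_def)
  have s: "(\<Sum>b\<in>(*) h ` B. fls_const (c b) * b) = h * (\<Sum>b\<in>B. fls_const (c (h * b)) * b)" for c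
    by (subst sum.reindex[OF inj]) (simp add: sum_distrib_left mult_ac)
  have mem: "h * a \<in> (*) h ` A \<longleftrightarrow> a \<in> A" for a A using h by auto
  show ?thesis
    unfolding basis_mod_def
  proof (intro conjI allI impI ballI)
    show "finite ((*) h ` B)" "(*) h ` B \<subseteq> (*) h ` V" using B by (auto simp: basis_mod_def)
  next
    fix c b assume "(\<Sum>b\<in>(*) h ` B. fls_const (c b) * b) \<in> (*) h ` W" and b: "b \<in> (*) h ` B"
    then have "(\<Sum>b\<in>B. fls_const (c (h * b)) * b) \<in> W" unfolding s mem by simp
    then have "\<forall>b\<in>B. c (h * b) = 0"
      using B unfolding basis_mod_def by (elim conjE allE[of _ "\<lambda>b. c (h * b)"]) blast
    then show "c b = 0" using b by auto
  next
    fix v assume "v \<in> (*) h ` V"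
    then obtain u where u: "u \<in> V" "v = h * u" by auto
    then obtain c where c: "u - (\<Sum>b\<in>B. fls_const (c b) * b) \<in> W"
      using B unfolding basis_mod_def by blast
    have "v - (\<Sum>b\<in>(*) h ` B. fls_const (c (b / h)) * b)
        = h * (u - (\<Sum>b\<in>B. fls_const (c b) * b))"
      unfolding s u using h by (simp add: right_diff_distrib)
    then show "\<exists>c. v - (\<Sum>b\<in>(*) h ` B. fls_const (c b) * b) \<in> (*) h ` W"
      using c by (intro exI[of _ "\<lambda>b. c (b / h)"]) auto
  qed
qed

lemma quotient_dim_mult:
  fixes h :: "'k::field fls"
  assumes h: "h \<noteq> 0"
  shows "quotient_dim ((*) h ` V) ((*) h ` W) = quotient_dim V W"
proof -
  have inj: "inj_on ((*) g) A" if "g \<noteq> 0" for g :: "'k fls" and A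
    using that by (auto simp: inj_on_def)
  have inv: "(*) (inverse h) ` (*) h ` A = A" for A
    using h by (simp add: image_image mult.assoc[symmetric])
  have "(\<exists>B. basis_mod ((*) h ` W) ((*) h ` V) B \<and> card B = n)
      \<longleftrightarrow> (\<exists>B. basis_mod W V B \<and> card B = n)" for n
    using basis_mod_mult[OF h, of W V] h
      basis_mod_mult[of "inverse h" "(*) h ` W" "(*) h ` V"]
    unfolding inv by (metis card_image inj inverse_zero_imp_zero)
  then show ?thesis unfolding quotient_dim_def by simp
qed

lemma cm_type_parameter_independent:
  fixes x y :: "'k::field fls"
  assumes "x \<in> nonunits R" "y \<in> nonunits R" "x \<noteq> 0" "y \<noteq> 0"
  shows "cm_type R x = cm_type R y"
proof -
  have sub: "(*) (v / u) ` socle_preimage R u \<subseteq> socle_preimage R v"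
    if "v \<in> nonunits R" "u \<noteq> 0" for u v :: "'k fls"
  proof
    fix z assume "z \<in> (*) (v / u) ` socle_preimage R u"
    then obtain a where a: "a \<in> socle_preimage R u" "z = v / u * a" by auto
    have *: "\<exists>q\<in>R. a * w = u * q" if "w \<in> nonunits R" for w
      using a that by (auto simp: socle_preimage_def principal_ideal_def)
    from *[OF that(1)] obtain q where q: "q \<in> R" "a * v = u * q" by blast
    then have "z = q" using a that by (simp add: field_simps)
    moreover have "z * w \<in> principal_ideal R v" if w: "w \<in> nonunits R" for w
    proof -
      from *[OF w] obtain p where p: "p \<in> R" "a * w = u * p" by blast
      have "z * w = v / u * (a * w)" using a by simp
      also have "\<dots> = v * p" using p \<open>u \<noteq> 0\<close> by simp
      finally show ?thesis using p by (auto simp: principal_ideal_def)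
    qed
    ultimately show "z \<in> socle_preimage R v" using q by (auto simp: socle_preimage_def)
  qed
  have "(*) (y / x) ` socle_preimage R x = socle_preimage R y"
  proof
    show "(*) (y / x) ` socle_preimage R x \<subseteq> socle_preimage R y" using sub assms by blast
    show "socle_preimage R y \<subseteq> (*) (y / x) ` socle_preimage R x"
    proof
      fix z assume "z \<in> socle_preimage R y"
      then have "x / y * z \<in> socle_preimage R x" using sub[of x y] assms by blast
      then show "z \<in> (*) (y / x) ` socle_preimage R x"
        using assms by (intro image_eqI[of _ _ "x / y * z"]) auto
    qed
  qed
  moreover have "(*) (y / x) ` principal_ideal R x = principal_ideal R y"
    using assms by (force simp: principal_ideal_def image_iff)
  ultimately show ?thesis
    unfolding cm_type_def using quotient_dim_mult[of "y / x"] assms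
    by (metis divide_eq_0_iff)
qed


subsection \<open>Invariants of \<open>k[[S]]\<close>\<close>

definition sg_type :: "'k::field itself \<Rightarrow> nat set \<Rightarrow> nat" where
  "sg_type _ S = cm_type (semigroup_ring S :: 'k fls set) (fls_X ^ sg_multiplicity S)"

definition sg_reduced_type :: "'k::field itself \<Rightarrow> nat set \<Rightarrow> nat" where
  "sg_reduced_type _ S =
     reduced_type (semigroup_ring S :: 'k fls set) (fls_X ^ sg_multiplicity S)"

definition maximal_reduced_type :: "'k::field itself \<Rightarrow> nat set \<Rightarrow> bool" where
  "maximal_reduced_type k S \<longleftrightarrow> sg_reduced_type k S = sg_type k S"

end

theory Submission
  imports Defs
begin

text \<open>
  Given \<open>r > 0\<close>, put \<open>m = r + 1\<close> and, for \<open>q \<ge> 1\<close>, let \<open>S\<close> consist of the multiples of \<open>m\<close>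
  together with all integers from \<open>qm\<close> on.  Its largest gap is \<open>qm - 1\<close>, and the \<open>m\<close>
  integers ending there are the semigroup element \<open>(q - 1)m\<close> and \<open>r\<close> gaps.  Adding any
  nonzero element of \<open>S\<close> to one of these gaps lands at or beyond \<open>qm\<close>, so they are
  pseudo-Frobenius; any other gap is less than \<open>(q - 1)m\<close>, and adding \<open>m\<close> to it gives
  a gap again; and a negative \<open>f\<close> is not pseudo-Frobenius, because \<open>f + s\<close> is the gap \<open>qm - 1\<close>
  for some \<open>s \<ge> qm\<close>.  So type and reduced type are both \<open>r\<close>, and \<open>q\<close> is arbitrary.

  To read this off the ring-theoretic definitions, everything is expressed through the
  spaces \<open>series_on A\<close> of power series with exponents in \<open>A\<close>.  The ring \<open>k[[S]]\<close>
  (\<open>semigroup_ring_eq_series_on\<close>), the ideal generated by \<open>t\<^sup>m\<close>, the preimage of the socle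
  (\<open>socle_preimage_series_on\<close>) and the conductor (\<open>conductor_series_on\<close>) all have this form,
  and the quotient of one such space by another has as its dimension the number of exponents
  that the first allows and the second does not (\<open>quotient_dim_series_on\<close>).  This turns the
  type and the reduced type of an arbitrary numerical semigroup into cardinalities of sets of integers
  (\<open>sg_type_eq_card\<close>, \<open>sg_reduced_type_eq_card\<close>).
\<close>


section \<open>Power series with prescribed exponents\<close>

notation fps_nth (infixl \<open>$\<close> 75)
notation fls_nth (infixl \<open>$$\<close> 75)

definition series_on :: "nat set \<Rightarrow> 'k::field fls set" where
  "series_on A = {z. \<forall>n. z $$ n \<noteq> 0 \<longrightarrow> n \<in> int ` A}"

lemma series_onD: "z \<in> series_on A \<Longrightarrow> z $$ n \<noteq> 0 \<Longrightarrow> n \<in> int ` A"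
  by (simp add: series_on_def)

lemma series_on_nthD: "z \<in> series_on A \<Longrightarrow> z $$ int n \<noteq> 0 \<Longrightarrow> n \<in> A"
  using series_onD by fastforce

lemma series_on_nth_neg: "z \<in> series_on A \<Longrightarrow> n < 0 \<Longrightarrow> z $$ n = 0"
  using series_onD by fastforce

lemma series_on_mono: "A \<subseteq> B \<Longrightarrow> series_on A \<subseteq> series_on B"
  by (fastforce simp: series_on_def)

lemma series_on_iff: "z \<in> series_on A \<longleftrightarrow> (\<forall>n. n \<notin> int ` A \<longrightarrow> z $$ n = 0)"
  unfolding series_on_def by blast

lemma series_on_add: "z \<in> series_on A \<Longrightarrow> y \<in> series_on A \<Longrightarrow> z + y \<in> series_on A"
  by (simp add: series_on_iff)

lemma series_on_diff: "z \<in> series_on A \<Longrightarrow> y \<in> series_on A \<Longrightarrow> z - y \<in> series_on A"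
  by (simp add: series_on_iff)

lemma series_on_combination:
  assumes "B \<subseteq> series_on A"
  shows "(\<Sum>b\<in>B. fls_const (c b) * b) \<in> series_on A"
  using assms
proof (induction B rule: infinite_finite_induct)
  case (insert x F)
  have "fls_const (c x) * x \<in> series_on A"
    using insert.prems by (auto simp: series_on_def)
  then show ?case using insert by (simp add: series_on_add)
qed (auto simp: series_on_def)

lemma monomial_in_series_on [simp]: "(fls_X :: 'k::field fls) ^ n \<in> series_on A \<longleftrightarrow> n \<in> A"
  by (auto simp: series_on_def)

lemma fps_to_fls_in_series_on: "fps_to_fls f \<in> series_on A \<longleftrightarrow> (\<forall>n. f $ n \<noteq> 0 \<longrightarrow> n \<in> A)"
proof
  assume "fps_to_fls f \<in> series_on A"
  then show "\<forall>n. f $ n \<noteq> 0 \<longrightarrow> n \<in> A"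
    using series_on_nthD[of "fps_to_fls f" A] by simp
next
  assume f: "\<forall>n. f $ n \<noteq> 0 \<longrightarrow> n \<in> A"
  have "n \<in> int ` A" if "fps_to_fls f $$ n \<noteq> 0" for n
  proof -
    have "n = int (nat n)" "f $ nat n \<noteq> 0" using that by (auto split: if_splits)
    then show ?thesis using f by blast
  qed
  then show "fps_to_fls f \<in> series_on A" by (simp add: series_on_def)
qed

lemma series_on_cases:
  assumes "z \<in> series_on A"
  obtains f where "z = fps_to_fls f" "\<And>n. f $ n \<noteq> 0 \<Longrightarrow> n \<in> A"
proof
  show "z = fps_to_fls (fls_regpart z)" 
    by (intro fls_eqI) (simp add: series_on_nth_neg[OF assms])
  show "n \<in> A" if "fls_regpart z $ n \<noteq> 0" for n
    using series_on_nthD[OF assms] that by simp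
qed

lemma series_on_mult:
  assumes "z \<in> series_on A" "y \<in> series_on B" and "\<And>a b. a \<in> A \<Longrightarrow> b \<in> B \<Longrightarrow> a + b \<in> C"
  shows "z * y \<in> series_on C"
proof -
  obtain f where f: "z = fps_to_fls f" "\<And>n. f $ n \<noteq> 0 \<Longrightarrow> n \<in> A"
    using assms(1) series_on_cases by blast
  obtain g where g: "y = fps_to_fls g" "\<And>n. g $ n \<noteq> 0 \<Longrightarrow> n \<in> B"
    using assms(2) series_on_cases by blast
  have "n \<in> C" if n: "(f * g) $ n \<noteq> 0" for n
  proof -
    obtain i where "i \<in> {0..n}" "f $ i * g $ (n - i) \<noteq> 0"
      using n unfolding fps_mult_nth by (rule sum.not_neutral_contains_not_neutral)
    then show ?thesis using f(2)[of i] g(2)[of "n - i"] assms(3)[of i "n - i"] by auto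
  qed
  then show ?thesis using fps_to_fls_in_series_on[of "f * g" C] f(1) g(1)
    by (simp add: fls_times_fps_to_fls)
qed

lemma monomial_mult_nth: "(fls_X ^ m * z) $$ n = (z :: 'k::field fls) $$ (n - int m)"
  by (simp add: fls_X_power_times_conv_shift)

lemma monomial_mult_in_series_on:
  "fls_X ^ m * (z :: 'k::field fls) \<in> series_on ((+) m ` A) \<longleftrightarrow> z \<in> series_on A"
proof -
  have "n - int m \<in> int ` A \<longleftrightarrow> n \<in> int ` (+) m ` A" for n
    by (force simp: image_iff)
  moreover have "(\<forall>n. z $$ (n - int m) \<noteq> 0 \<longrightarrow> n - int m \<in> int ` A) \<longleftrightarrow> z \<in> series_on A"
    unfolding series_on_def by (auto dest: spec[of _ "_ + int m"])
  ultimately show ?thesis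
    by (simp add: series_on_def monomial_mult_nth)
qed

lemma principal_ideal_series_on:
  "principal_ideal (series_on A) (fls_X ^ m :: 'k::field fls) = series_on ((+) m ` A)"
proof
  show "principal_ideal (series_on A) (fls_X ^ m) \<subseteq> series_on ((+) m ` A)"
    by (auto simp: principal_ideal_def monomial_mult_in_series_on)
  show "series_on ((+) m ` A) \<subseteq> principal_ideal (series_on A) (fls_X ^ m :: 'k fls)"
  proof
    fix z :: "'k fls" assume z: "z \<in> series_on ((+) m ` A)"
    have *: "z = fls_X ^ m * (z / fls_X ^ m)"
      by (subst times_divide_eq_right) (rule nonzero_mult_div_cancel_left[symmetric], simp)
    have "z / fls_X ^ m \<in> series_on A"
      using z * monomial_mult_in_series_on by metis
    then show "z \<in> principal_ideal (series_on A) (fls_X ^ m)"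
      using * unfolding principal_ideal_def by blast
  qed
qed

lemma series_on_sum:
  "{z + y | z y. z \<in> series_on A \<and> y \<in> series_on B} = (series_on (A \<union> B) :: 'k::field fls set)"
proof
  show "{z + y | z y. z \<in> series_on A \<and> y \<in> series_on B} \<subseteq> (series_on (A \<union> B) :: 'k fls set)"
    using series_on_mono[of A "A \<union> B"] series_on_mono[of B "A \<union> B"]
    by (auto intro!: series_on_add)
  show "(series_on (A \<union> B) :: 'k fls set) \<subseteq> {z + y | z y. z \<in> series_on A \<and> y \<in> series_on B}"
  proof
    fix v :: "'k fls" assume "v \<in> series_on (A \<union> B)"
    then obtain f where f: "v = fps_to_fls f" "\<And>n. f $ n \<noteq> 0 \<Longrightarrow> n \<in> A \<union> B"
      using series_on_cases by blast
    define g where "g = Abs_fps (\<lambda>n. if n \<in> A then f $ n else 0)"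
    have "fps_to_fls g \<in> series_on A" "fps_to_fls (f - g) \<in> series_on B"
      using f(2) unfolding fps_to_fls_in_series_on by (auto simp: g_def split: if_splits)
    moreover have "v = fps_to_fls g + fps_to_fls (f - g)" by (simp add: f)
    ultimately show "v \<in> {z + y | z y. z \<in> series_on A \<and> y \<in> series_on B}" by blast
  qed
qed

interpretation fls_space: vector_space "\<lambda>c (z :: 'k::field fls). fls_const c * z"
  by unfold_locales (simp_all add: algebra_simps flip: fls_plus_const)

text \<open>
  The monomials with exponent in \<open>A - B\<close> give one basis.  Truncating a series to these
  exponents is a map on \<open>series_on A\<close> that kills exactly the elements of \<open>series_on B\<close>, so it maps every other basis of the quotient to a
  basis of the same span of monomials; hence the cardinality is well defined.
\<close>

lemma quotient_dim_series_on:
  fixes A B :: "nat set"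
  assumes fin: "finite (A - B)"
  shows "quotient_dim (series_on A :: 'k::field fls set) (series_on B) = card (A - B)"
proof -
  let ?V = "series_on A :: 'k fls set" and ?W = "series_on B :: 'k fls set"
  let ?M = "(\<lambda>d. fls_X ^ d :: 'k fls)" and ?D = "A - B"
  define tr where "tr z = (\<Sum>d\<in>?D. fls_const (z $$ int d) * ?M d)" for z :: "'k fls"
  have inj: "inj_on ?M X" for X
    by (rule inj_onI) (metis fls_subdegree_fls_X_pow of_nat_eq_iff)
  have nth: "(\<Sum>d\<in>?D. fls_const (c d) * ?M d) $$ int e = (if e \<in> ?D then c e else 0)" for c e
    using fin by (simp add: fls_nth_sum if_distrib sum.delta' cong: if_cong)
  have nth': "(\<Sum>d\<in>?D. fls_const (c d) * ?M d) $$ n = 0" if "n \<notin> int ` ?D" for c n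
    unfolding fls_nth_sum using that by (intro sum.neutral) auto
  have tr_nth: "tr z $$ n = (if n \<in> int ` ?D then z $$ n else 0)" for z n
    using nth[of "\<lambda>d. z $$ int d"] nth' unfolding tr_def by auto
  have tr_comb: "tr (\<Sum>b\<in>E. fls_const (c b) * b) = (\<Sum>b\<in>E. fls_const (c b) * tr b)"
    for E :: "'k fls set" and c
    by (intro fls_eqI) (simp add: tr_nth fls_nth_sum)
  have tr_diff: "tr (y - z) = tr y - tr z" for y z
    by (intro fls_eqI) (simp add: tr_nth)
  have ker: "tr z = 0 \<longleftrightarrow> z \<in> ?W" if z: "z \<in> ?V" for z
  proof
    assume "tr z = 0"
    then have "z $$ n = 0" if "n \<in> int ` ?D" for n using tr_nth[of z n] that by simp
    moreover have "int ` A - int ` B = int ` ?D" by auto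
    ultimately show "z \<in> ?W" using z unfolding series_on_def by blast
  next
    assume "z \<in> ?W"
    then have "z $$ n = 0" if "n \<in> int ` ?D" for n using series_onD that by fastforce
    then show "tr z = 0" by (intro fls_eqI) (simp add: tr_nth)
  qed
  have indep: "fls_space.independent (?M ` ?D)"
  proof (rule fls_space.independent_if_scalars_zero)
    show "finite (?M ` ?D)" using fin by simp
    fix f x assume s: "(\<Sum>x\<in>?M ` ?D. fls_const (f x) * x) = 0" and "x \<in> ?M ` ?D"
    then obtain d where d: "x = ?M d" "d \<in> ?D" by blast
    have "(\<Sum>d\<in>?D. fls_const (f (?M d)) * ?M d) = 0"
      using s by (simp add: sum.reindex[OF inj])
    then show "f x = 0" using nth[of "\<lambda>d. f (?M d)" d] d by simp
  qed
  have tr_span: "tr z \<in> fls_space.span (?M ` ?D)" for z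
    unfolding tr_def
    by (intro fls_space.span_sum fls_space.span_scale fls_space.span_base) auto

  have "basis_mod ?W ?V (?M ` ?D)"
    unfolding basis_mod_def
  proof (intro conjI allI impI ballI)
    show "finite (?M ` ?D)" "?M ` ?D \<subseteq> ?V" using fin by auto
  next
    fix c b assume s: "(\<Sum>b\<in>?M ` ?D. fls_const (c b) * b) \<in> ?W" and "b \<in> ?M ` ?D"
    then obtain d where d: "b = ?M d" "d \<in> ?D" by blast
    have "(\<Sum>d\<in>?D. fls_const (c (?M d)) * ?M d) \<in> ?W"
      using s by (simp add: sum.reindex[OF inj])
    from series_on_nthD[OF this, of d] show "c b = 0"
      using nth[of "\<lambda>d. c (?M d)" d] d by auto
  next
    fix v assume v: "v \<in> ?V"
    define c where "c = (\<lambda>b :: 'k fls. v $$ fls_subdegree b)"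
    have eq: "(\<Sum>b\<in>?M ` ?D. fls_const (c b) * b) = tr v"
      by (simp add: sum.reindex[OF inj] c_def tr_def)
    have "?M ` ?D \<subseteq> ?V" by auto
    then have "v - tr v \<in> ?V"
      unfolding eq[symmetric] by (intro series_on_diff v series_on_combination)
    moreover have "tr (v - tr v) = 0" by (intro fls_eqI) (simp add: tr_nth)
    ultimately show "\<exists>c. v - (\<Sum>b\<in>?M ` ?D. fls_const (c b) * b) \<in> ?W"
      using ker eq by metis
  qed
  moreover have "card (?M ` ?D) = card ?D" by (simp add: card_image[OF inj])
  moreover have "card E = card ?D" if E: "basis_mod ?W ?V E" for E
  proof -
    note E_fin = E[unfolded basis_mod_def, THEN conjunct1]
      and E_sub = E[unfolded basis_mod_def, THEN conjunct2, THEN conjunct1]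
      and E_ind = E[unfolded basis_mod_def, THEN conjunct2, THEN conjunct2, THEN conjunct1]
      and E_gen = E[unfolded basis_mod_def, THEN conjunct2, THEN conjunct2, THEN conjunct2]
    have ind: "c b = 0" if "(\<Sum>b\<in>E. fls_const (c b) * tr b) = 0" "b \<in> E" for c b
    proof -
      have "tr (\<Sum>b\<in>E. fls_const (c b) * b) = 0" using that(1) by (simp add: tr_comb)
      then have "(\<Sum>b\<in>E. fls_const (c b) * b) \<in> ?W"
        using ker[OF series_on_combination[OF E_sub]] by simp
      then show ?thesis using E_ind that(2) by simp
    qed
    have tr_inj: "inj_on tr E"
    proof (rule inj_onI, rule ccontr)
      fix x y assume xy: "x \<in> E" "y \<in> E" "tr x = tr y" "x \<noteq> y"
      define c where "c = (\<lambda>b. if b = x then 1 else if b = y then - 1 else (0::'k))"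
      have "(\<Sum>b\<in>E. fls_const (c b) * tr b) = (\<Sum>b\<in>{x, y}. fls_const (c b) * tr b)"
        using xy E_fin by (intro sum.mono_neutral_right) (auto simp: c_def)
      also have "\<dots> = 0" using xy by (simp add: c_def fls_const_uminus)
      finally show False using ind[of c x] xy by (simp add: c_def)
    qed
    have "fls_space.independent (tr ` E)"
    proof (rule fls_space.independent_if_scalars_zero)
      show "finite (tr ` E)" using E_fin by simp
      fix f x assume s: "(\<Sum>x\<in>tr ` E. fls_const (f x) * x) = 0" and x: "x \<in> tr ` E"
      from s have "(\<Sum>b\<in>E. fls_const (f (tr b)) * tr b) = 0"
        by (simp add: sum.reindex[OF tr_inj])
      from ind[OF this] show "f x = 0" using x by blast
    qed
    then have "card (tr ` E) \<le> card (?M ` ?D)"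
      using fls_space.independent_span_bound[of "?M ` ?D" "tr ` E"] fin tr_span by blast
    moreover have "?M ` ?D \<subseteq> fls_space.span (tr ` E)"
    proof
      fix x assume x: "x \<in> ?M ` ?D"
      then have xV: "x \<in> ?V" by auto
      then obtain c where c: "x - (\<Sum>b\<in>E. fls_const (c b) * b) \<in> ?W" using E_gen by blast
      moreover have "x - (\<Sum>b\<in>E. fls_const (c b) * b) \<in> ?V"
        by (intro series_on_diff xV series_on_combination E_sub)
      ultimately have "tr (x - (\<Sum>b\<in>E. fls_const (c b) * b)) = 0" by (simp add: ker)
      then have "tr x = (\<Sum>b\<in>E. fls_const (c b) * tr b)"
        by (simp add: tr_diff tr_comb)
      moreover have "tr x = x" using x by (intro fls_eqI) (auto simp: tr_nth)
      ultimately have "x = (\<Sum>b\<in>E. fls_const (c b) * tr b)" by simp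
      then show "x \<in> fls_space.span (tr ` E)"
        by (rule ssubst)
          (intro fls_space.span_sum fls_space.span_scale fls_space.span_base imageI)
    qed
    then have "card (?M ` ?D) \<le> card (tr ` E)"
      using fls_space.independent_span_bound[OF _ indep] E_fin by blast
    ultimately show ?thesis by (simp add: card_image[OF inj] card_image[OF tr_inj])
  qed
  ultimately show ?thesis
    unfolding quotient_dim_def by (intro the_equality) (metis, metis)
qed


section \<open>The ring of a numerical semigroup\<close>

lemma numerical_semigroupD:
  assumes "numerical_semigroup S"
  shows "0 \<in> S" "\<And>a b. a \<in> S \<Longrightarrow> b \<in> S \<Longrightarrow> a + b \<in> S" "finite (- S)"
  using assms by (auto simp: numerical_semigroup_def Compl_eq_Diff_UNIV)

lemma numerical_semigroup_mult:
  assumes "numerical_semigroup S" "s \<in> S"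
  shows "k * s \<in> S"
  by (induction k) (auto intro: numerical_semigroupD[OF assms(1)] assms(2))

lemma numerical_semigroup_nonzero_element:
  assumes "numerical_semigroup S"
  shows "\<exists>s. s \<in> S \<and> s \<noteq> 0"
proof (rule ccontr)
  assume "\<not> ?thesis"
  then have "UNIV = - S \<union> {0}" by auto
  then show False
    using numerical_semigroupD(3)[OF assms]
    by (metis finite.emptyI finite_Un finite_insert infinite_UNIV_nat)
qed

lemma sum_minimal_generators_in:
  assumes S: "numerical_semigroup S" and "set_mset A \<subseteq> minimal_generators S"
  shows "\<Sum>\<^sub># A \<in> S"
  using assms(2)
  by (induction A) (auto simp: minimal_generators_def intro: numerical_semigroupD[OF S])

lemma exists_sum_minimal_generators:
  "n \<in> S \<Longrightarrow> \<exists>A. set_mset A \<subseteq> minimal_generators S \<and> \<Sum>\<^sub># A = n"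
proof (induction n rule: less_induct)
  case (less n)
  consider "n = 0" | "n \<in> minimal_generators S"
    | a b where "a \<in> S - {0}" "b \<in> S - {0}" "n = a + b"
    using less.prems unfolding minimal_generators_def by blast
  then show ?case
  proof cases
    case 1
    then show ?thesis by (intro exI[of _ "{#}"]) simp
  next
    case 2
    then show ?thesis by (intro exI[of _ "{#n#}"]) simp
  next
    case 3
    then obtain A B where "set_mset A \<subseteq> minimal_generators S" "\<Sum>\<^sub># A = a"
      "set_mset B \<subseteq> minimal_generators S" "\<Sum>\<^sub># B = b"
      using less.IH[of a] less.IH[of b] by auto
    then show ?thesis using 3 by (intro exI[of _ "A + B"]) simp
  qed
qed

lemma finite_factorizations:
  assumes "0 \<notin> G"
  shows "finite {A. set_mset A \<subseteq> G \<and> \<Sum>\<^sub># A = (n::nat)}"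
proof (rule finite_subset)
  show "finite (mset ` {xs. set xs \<subseteq> {..n} \<and> length xs \<le> n})"
    by (intro finite_imageI finite_lists_length_le) simp
  show "{A. set_mset A \<subseteq> G \<and> \<Sum>\<^sub># A = n} \<subseteq> mset ` {xs. set xs \<subseteq> {..n} \<and> length xs \<le> n}"
  proof
    fix A assume "A \<in> {A. set_mset A \<subseteq> G \<and> \<Sum>\<^sub># A = n}"
    then have A: "set_mset A \<subseteq> G" "\<Sum>\<^sub># A = n" by auto
    obtain xs where xs: "A = mset xs" using ex_mset[of A] by auto
    have "size A \<le> \<Sum>\<^sub># A"
      using A(1) assms
    proof (induction A)
      case (add x A)
      then have "x \<noteq> 0" by (metis in_mono union_single_eq_member)
      then show ?case using add by simp
    qed simp
    moreover have "x \<le> \<Sum>\<^sub># A" if "x \<in># A" for x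
      using that by (auto dest!: multi_member_split)
    ultimately show "A \<in> mset ` {xs. set xs \<subseteq> {..n} \<and> length xs \<le> n}"
      using A xs by auto
  qed
qed

text \<open>
  Substitution into a power series in the generators can be inverted by choosing one
  factorization of each element of \<open>S\<close> and putting the whole coefficient on it.
\<close>

lemma semigroup_ring_eq_series_on:
  assumes S: "numerical_semigroup S"
  shows "semigroup_ring S = (series_on S :: 'k::field fls set)"
proof
  show "semigroup_ring S \<subseteq> (series_on S :: 'k fls set)"
  proof
    fix z :: "'k fls" assume "z \<in> semigroup_ring S"
    then obtain c :: "nat multiset \<Rightarrow> 'k" where z: "z = fps_to_fls
        (Abs_fps (\<lambda>n. \<Sum>A | set_mset A \<subseteq> minimal_generators S \<and> \<Sum>\<^sub># A = n. c A))"
      unfolding semigroup_ring_def by blast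
    have "n \<in> S"
      if "(\<Sum>A | set_mset A \<subseteq> minimal_generators S \<and> \<Sum>\<^sub># A = n. c A) \<noteq> 0" for n
    proof -
      have "\<exists>A. set_mset A \<subseteq> minimal_generators S \<and> \<Sum>\<^sub># A = n"
        using that by (rule sum.not_neutral_contains_not_neutral) blast
      then show ?thesis using sum_minimal_generators_in[OF S] by blast
    qed
    then show "z \<in> series_on S" by (simp add: z fps_to_fls_in_series_on)
  qed
  show "(series_on S :: 'k fls set) \<subseteq> semigroup_ring S"
  proof
    fix z :: "'k fls" assume "z \<in> series_on S"
    then obtain f where f: "z = fps_to_fls f" "\<And>n. f $ n \<noteq> 0 \<Longrightarrow> n \<in> S"
      using series_on_cases by blast
    obtain F where F: "\<And>n. n \<in> S \<Longrightarrow> set_mset (F n) \<subseteq> minimal_generators S \<and> \<Sum>\<^sub># (F n) = n"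
      using exists_sum_minimal_generators[of _ S] by metis
    define c where "c A = (if A = F (\<Sum>\<^sub># A) then f $ (\<Sum>\<^sub># A) else 0)" for A
    have "(\<Sum>A | set_mset A \<subseteq> minimal_generators S \<and> \<Sum>\<^sub># A = n. c A) = f $ n" for n
    proof -
      have fin: "finite {A. set_mset A \<subseteq> minimal_generators S \<and> \<Sum>\<^sub># A = n}"
        by (rule finite_factorizations) (simp add: minimal_generators_def)
      have "(\<Sum>A | set_mset A \<subseteq> minimal_generators S \<and> \<Sum>\<^sub># A = n. c A)
          = (\<Sum>A | set_mset A \<subseteq> minimal_generators S \<and> \<Sum>\<^sub># A = n. if A = F n then f $ n else 0)"
        by (rule sum.cong) (auto simp: c_def)
      also have "\<dots> = (if F n \<in> {A. set_mset A \<subseteq> minimal_generators S \<and> \<Sum>\<^sub># A = n}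
          then f $ n else 0)"
        using fin by (simp add: sum.delta)
      also have "\<dots> = f $ n" using F[of n] f(2)[of n] by auto
      finally show ?thesis .
    qed
    then have "z = fps_to_fls
        (Abs_fps (\<lambda>n. \<Sum>A | set_mset A \<subseteq> minimal_generators S \<and> \<Sum>\<^sub># A = n. c A))"
      by (simp add: f(1) fps_nth_inverse)
    then show "z \<in> semigroup_ring S" unfolding semigroup_ring_def by blast
  qed
qed

text \<open>
  The inverse satisfies a recursion whose terms are indexed by \<open>n = i + (n - i)\<close> with \<open>i \<in> S\<close>,
  so by induction no exponent outside \<open>S\<close> can appear.
\<close>

lemma fps_inverse_support:
  fixes f :: "'k::field fps"
  assumes S: "numerical_semigroup S" and f: "\<And>n. f $ n \<noteq> 0 \<Longrightarrow> n \<in> S" and f0: "f $ 0 \<noteq> 0"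
  shows "inverse f $ n \<noteq> 0 \<Longrightarrow> n \<in> S"
proof (induction n rule: less_induct)
  case (less n)
  show ?case
  proof (cases "n = 0")
    case True
    then show ?thesis using numerical_semigroupD(1)[OF S] by simp
  next
    case False
    have "f * inverse f = 1" using f0 by (rule inverse_mult_eq_1')
    then have "(\<Sum>i=0..n. f $ i * inverse f $ (n - i)) = 0"
      using False by (metis fps_mult_nth fps_one_nth)
    moreover have "(\<Sum>i=0..n. f $ i * inverse f $ (n - i))
        = f $ 0 * inverse f $ n + (\<Sum>i=1..n. f $ i * inverse f $ (n - i))"
      by (simp add: sum.atLeast_Suc_atMost)
    ultimately have "(\<Sum>i=1..n. f $ i * inverse f $ (n - i)) \<noteq> 0"
      using f0 less.prems by auto
    then obtain i where "i \<in> {1..n}" "f $ i * inverse f $ (n - i) \<noteq> 0"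
      by (rule sum.not_neutral_contains_not_neutral)
    then have "f $ i \<noteq> 0" "inverse f $ (n - i) \<noteq> 0" "n - i < n" "i \<le> n" by auto
    then show ?thesis
      using f less.IH numerical_semigroupD(2)[OF S, of i "n - i"] by auto
  qed
qed

lemma nonunits_series_on:
  assumes S: "numerical_semigroup S"
  shows "nonunits (series_on S) = (series_on (S - {0}) :: 'k::field fls set)"
proof
  show "nonunits (series_on S) \<subseteq> (series_on (S - {0}) :: 'k fls set)"
  proof
    fix z :: "'k fls" assume z: "z \<in> nonunits (series_on S)"
    then obtain f where f: "z = fps_to_fls f" "\<And>n. f $ n \<noteq> 0 \<Longrightarrow> n \<in> S"
      using series_on_cases unfolding nonunits_def by blast
    have "f $ 0 = 0"
    proof (rule ccontr)
      assume f0: "f $ 0 \<noteq> 0"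
      have "fps_to_fls (inverse f) \<in> series_on S"
        using fps_inverse_support[OF S f(2) f0] by (simp add: fps_to_fls_in_series_on)
      moreover have "z * fps_to_fls (inverse f) = 1"
        using inverse_mult_eq_1'[OF f0] by (simp add: f(1) flip: fls_times_fps_to_fls)
      ultimately show False using z unfolding nonunits_def by blast
    qed
    then have "n \<in> S - {0}" if "f $ n \<noteq> 0" for n using f(2) that by (cases "n = 0") auto
    then show "z \<in> series_on (S - {0})" by (simp add: f(1) fps_to_fls_in_series_on)
  qed
  show "(series_on (S - {0}) :: 'k fls set) \<subseteq> nonunits (series_on S)"
  proof
    fix z :: "'k fls" assume z: "z \<in> series_on (S - {0})"
    have "z * y \<noteq> 1" if "y \<in> series_on S" for y
    proof
      assume "z * y = 1"
      moreover have "z * y \<in> series_on (UNIV - {0})"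
        using z that by (rule series_on_mult) auto
      ultimately show False using monomial_in_series_on[of 0 "UNIV - {0}", where 'k = 'k] by simp
    qed
    then show "z \<in> nonunits (series_on S)"
      using z series_on_mono[of "S - {0}" S] unfolding nonunits_def by blast
  qed
qed

text \<open>Membership in the socle need only be tested against the monomials \<open>t\<^sup>s\<close> with \<open>s \<in> S - {0}\<close>.\<close>

lemma socle_preimage_series_on:
  assumes S: "numerical_semigroup S"
  shows "socle_preimage (series_on S) (fls_X ^ m)
    = (series_on {a \<in> S. \<forall>s\<in>S - {0}. a + s \<in> (+) m ` S} :: 'k::field fls set)"
    (is "_ = series_on ?T")
proof
  show "socle_preimage (series_on S) (fls_X ^ m) \<subseteq> (series_on ?T :: 'k fls set)"
  proof
    fix z :: "'k fls" assume z: "z \<in> socle_preimage (series_on S) (fls_X ^ m)"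
    then have zS: "z \<in> series_on S"
      and zy: "\<And>y. y \<in> series_on (S - {0}) \<Longrightarrow> z * y \<in> series_on ((+) m ` S)"
      unfolding socle_preimage_def nonunits_series_on[OF S] principal_ideal_series_on by auto
    obtain f where f: "z = fps_to_fls f" "\<And>n. f $ n \<noteq> 0 \<Longrightarrow> n \<in> S"
      using zS series_on_cases by blast
    have "n + s \<in> (+) m ` S" if n: "f $ n \<noteq> 0" and s: "s \<in> S - {0}" for n s
    proof -
      have "fls_X ^ s * z \<in> series_on ((+) m ` S)"
        using zy[of "fls_X ^ s"] s by (simp add: mult.commute)
      from series_on_nthD[OF this, of "n + s"] show ?thesis
        using n by (simp add: monomial_mult_nth f(1))
    qed
    then show "z \<in> series_on ?T" using f by (simp add: fps_to_fls_in_series_on)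
  qed
  show "(series_on ?T :: 'k fls set) \<subseteq> socle_preimage (series_on S) (fls_X ^ m)"
    unfolding socle_preimage_def nonunits_series_on[OF S] principal_ideal_series_on
    using series_on_mono[of ?T S] by (auto intro: series_on_mult)
qed

lemma quotient_field_series_on:
  assumes S: "numerical_semigroup S"
  shows "quotient_field (series_on S) = (UNIV :: 'k::field fls set)"
proof -
  have "z \<in> quotient_field (series_on S)" for z :: "'k fls"
  proof -
    obtain N where "\<forall>n\<in>- S. n < N"
      using numerical_semigroupD(3)[OF S] unfolding finite_nat_set_iff_bounded by blast
    have N: "n \<in> S" if "n \<ge> N" for n
    proof (rule ccontr)
      assume "n \<notin> S"
      then have "n < N" using \<open>\<forall>n\<in>- S. n < N\<close> by simp
      then show False using that by simp
    qed
    define M where "M = N + nat (- fls_subdegree z)"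
    have "n \<in> int ` S" if "(fls_X ^ M * z) $$ n \<noteq> 0" for n
    proof -
      have "fls_subdegree z \<le> n - int M"
        using that by (intro fls_subdegree_leI) (simp add: monomial_mult_nth)
      then have "n \<ge> int N" unfolding M_def by linarith
      then have "n = int (nat n)" "nat n \<in> S" using N[of "nat n"] by auto
      then show ?thesis by blast
    qed
    then have "fls_X ^ M * z \<in> series_on S" by (simp add: series_on_def)
    moreover have "fls_X ^ M \<in> (series_on S :: 'k fls set)" using N by (simp add: M_def)
    moreover have "z = fls_X ^ M * z / fls_X ^ M"
      by (rule nonzero_mult_div_cancel_left[symmetric]) simp
    moreover have "(fls_X :: 'k fls) ^ M \<noteq> 0" by simp
    ultimately show ?thesis unfolding quotient_field_def by blast
  qed
  then show ?thesis by blast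
qed

text \<open>
  In an integral equation of a series of negative order, the leading power would be the
  only term of lowest order.
\<close>

lemma integral_closure_subset_power_series:
  "integral_closure (series_on S) \<subseteq> (series_on UNIV :: 'k::field fls set)"
proof
  fix z :: "'k fls" assume "z \<in> integral_closure (series_on S)"
  then obtain p where p: "lead_coeff p = 1" "\<And>i. coeff p i \<in> series_on S" "poly p z = 0"
    unfolding integral_closure_def by blast
  let ?d = "degree p" and ?v = "fls_subdegree z"
  have "?v \<ge> 0"
  proof (rule ccontr)
    assume v: "\<not> ?v \<ge> 0"
    then have z0: "z \<noteq> 0" by auto
    have low: "(coeff p i * z ^ i) $$ (int ?d * ?v) = 0" if "i < ?d" for i
    proof -
      have "fls_subdegree (coeff p i) \<ge> 0"
        by (intro fls_subdegree_ge0I series_on_nth_neg[OF p(2)])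
      moreover have "int ?d * ?v < int i * ?v" using v that by (intro mult_strict_right_mono_neg) auto
      ultimately show ?thesis by (intro fls_times_nth_eq0) (simp add: fls_subdegree_pow)
    qed
    have "0 = poly p z $$ (int ?d * ?v)" by (simp add: p)
    also have "\<dots> = (\<Sum>i\<le>?d. (coeff p i * z ^ i) $$ (int ?d * ?v))"
      by (simp add: poly_altdef fls_nth_sum)
    also have "\<dots> = (coeff p ?d * z ^ ?d) $$ (int ?d * ?v)"
      using low by (subst sum.remove[of _ ?d]) (auto intro!: sum.neutral)
    also have "\<dots> = z ^ ?d $$ fls_subdegree (z ^ ?d)"
      by (simp add: p fls_subdegree_pow)
    also have "\<dots> \<noteq> 0" using z0 by (intro nth_fls_subdegree_nonzero) simp
    finally show False by simp
  qed
  then have "n \<in> range int" if "z $$ n \<noteq> 0" for n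
    using fls_subdegree_leI[OF that] by (metis nonneg_int_cases order_trans rangeI)
  then show "z \<in> series_on UNIV" by (simp add: series_on_def)
qed

text \<open>The monomial \<open>t\<^sup>i\<close> is a root of \<open>X\<^sup>s - t\<^bsup>is\<^esup>\<close> for any positive \<open>s\<close> in \<open>S\<close>.\<close>

lemma monomial_in_integral_closure:
  assumes S: "numerical_semigroup S"
  shows "(fls_X :: 'k::field fls) ^ i \<in> integral_closure (series_on S)"
proof -
  obtain s where s: "s \<in> S" "s > 0"
    using numerical_semigroup_nonzero_element[OF S] by blast
  let ?p = "monom 1 s + [:- (fls_X ^ (i * s)):] :: 'k fls poly"
  have deg: "degree ?p = s"
    using s(2) by (simp add: degree_add_eq_left degree_monom_eq)
  have "lead_coeff ?p = 1" using s(2) deg by (simp add: coeff_pCons split: nat.splits)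
  moreover have "coeff ?p j \<in> series_on S" for j
  proof -
    have "0 \<in> series_on S" "1 \<in> series_on S"
      using numerical_semigroupD(1)[OF S] by (auto simp: series_on_def)
    moreover have "fls_X ^ (i * s) \<in> (series_on S :: 'k fls set)"
      using numerical_semigroup_mult[OF S s(1)] by simp
    moreover from this have "- (fls_X ^ (i * s)) \<in> (series_on S :: 'k fls set)"
      by (simp add: series_on_iff)
    ultimately show ?thesis
      by (auto simp: coeff_pCons split: nat.splits intro!: series_on_add)
  qed
  moreover have "poly ?p (fls_X ^ i) = 0" by (simp add: poly_monom power_mult)
  ultimately show ?thesis
    unfolding integral_closure_def quotient_field_series_on[OF S] by blast
qed

text \<open>
  Multiplying by monomials alone shows that exponents of an element of the conductor stay
  in \<open>S\<close> under every shift; conversely this suffices, because integral elements are power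
  series.
\<close>

lemma conductor_series_on:
  assumes S: "numerical_semigroup S"
  shows "conductor (series_on S) = (series_on {n. \<forall>i. n + i \<in> S} :: 'k::field fls set)"
    (is "_ = series_on ?C")
proof
  show "conductor (series_on S) \<subseteq> (series_on ?C :: 'k fls set)"
  proof
    fix z :: "'k fls" assume "z \<in> conductor (series_on S)"
    then have shift: "fls_X ^ i * z \<in> series_on S" for i
      using monomial_in_integral_closure[OF S, of i, where 'k = 'k] unfolding conductor_def
      by (simp add: mult.commute[of _ z])
    have "z \<in> series_on S" using shift[of 0] by simp
    then obtain f where f: "z = fps_to_fls f" using series_on_cases by blast
    have "n + i \<in> S" if "f $ n \<noteq> 0" for n i
      using series_on_nthD[OF shift[of i], of "n + i"] that
      by (simp add: monomial_mult_nth f)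
    then show "z \<in> series_on ?C" by (simp add: f fps_to_fls_in_series_on)
  qed
  show "(series_on ?C :: 'k fls set) \<subseteq> conductor (series_on S)"
    using integral_closure_subset_power_series[of S, where 'k = 'k]
    by (auto simp: conductor_def quotient_field_series_on[OF S] intro: series_on_mult)
qed


section \<open>Type and reduced type as cardinalities\<close>

lemma finite_Compl_shift:
  assumes "numerical_semigroup S"
  shows "finite (- ((+) m ` S))"
proof (rule finite_subset)
  show "finite ({..<m} \<union> (+) m ` (- S))" using numerical_semigroupD(3)[OF assms] by simp
  show "- ((+) m ` S) \<subseteq> {..<m} \<union> (+) m ` (- S)"
  proof
    fix n assume n: "n \<in> - ((+) m ` S)"
    show "n \<in> {..<m} \<union> (+) m ` (- S)"
    proof (cases "n < m")
      case False
      then have "n = m + (n - m)" by simp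
      then have "n - m \<notin> S" "n = m + (n - m)" using n by force+
      then show ?thesis by blast
    qed simp
  qed
qed

lemma sg_multiplicity_in:
  assumes "numerical_semigroup S"
  shows "sg_multiplicity S \<in> S"
proof -
  have "sg_multiplicity S \<in> S \<and> sg_multiplicity S \<noteq> 0"
    unfolding sg_multiplicity_def
    using numerical_semigroup_nonzero_element[OF assms] by (rule LeastI_ex)
  then show ?thesis by simp
qed

text \<open>
  The set counted here is the set of pseudo-Frobenius numbers, shifted upwards by the
  multiplicity.
\<close>

lemma sg_type_eq_card:
  assumes S: "numerical_semigroup S" and m: "sg_multiplicity S = m"
  shows "sg_type TYPE('k::field) S
    = card ({a \<in> S. \<forall>s\<in>S - {0}. a + s \<in> (+) m ` S} - (+) m ` S)"
  unfolding sg_type_def cm_type_def m semigroup_ring_eq_series_on[OF S]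
    socle_preimage_series_on[OF S] principal_ideal_series_on
  by (rule quotient_dim_series_on) (rule finite_subset[OF _ finite_Compl_shift[OF S]], blast)

text \<open>
  Subtracting the multiplicity turns the set counted here into the set of integers
  greater than \<open>F(S) - m(S)\<close> that are not in \<open>S\<close>.
\<close>

lemma sg_reduced_type_eq_card:
  assumes S: "numerical_semigroup S" and m: "sg_multiplicity S = m"
  shows "sg_reduced_type TYPE('k::field) S = card ({n. \<forall>i. n + i \<in> S} - (+) m ` S)"
proof -
  let ?C = "{n. \<forall>i. n + i \<in> S}"
  have "sg_reduced_type TYPE('k) S = card (?C \<union> (+) m ` S - (+) m ` S)"
    unfolding sg_reduced_type_def reduced_type_def m semigroup_ring_eq_series_on[OF S]
      conductor_series_on[OF S] principal_ideal_series_on series_on_sum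
    by (rule quotient_dim_series_on)
      (rule finite_subset[OF _ finite_Compl_shift[OF S]], blast)
  also have "?C \<union> (+) m ` S - (+) m ` S = ?C - (+) m ` S" by blast
  finally show ?thesis .
qed


section \<open>Multiples of \<open>m\<close> and all large integers\<close>

definition multiples_or_ge :: "nat \<Rightarrow> nat \<Rightarrow> nat set" where
  "multiples_or_ge m q = {n. m dvd n \<or> q * m \<le> n}"

lemma numerical_semigroup_multiples_or_ge: "numerical_semigroup (multiples_or_ge m q)"
proof -
  have "UNIV - multiples_or_ge m q \<subseteq> {..<q * m}" by (auto simp: multiples_or_ge_def)
  then have "finite (UNIV - multiples_or_ge m q)" by (rule finite_subset) simp
  then show ?thesis by (auto simp: numerical_semigroup_def multiples_or_ge_def)
qed

lemma sg_multiplicity_multiples_or_ge: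
  assumes "m > 0" "q > 0"
  shows "sg_multiplicity (multiples_or_ge m q) = m"
  unfolding sg_multiplicity_def
proof (rule Least_equality)
  show "m \<in> multiples_or_ge m q \<and> m \<noteq> 0" using assms by (simp add: multiples_or_ge_def)
  show "m \<le> n" if "n \<in> multiples_or_ge m q \<and> n \<noteq> 0" for n
  proof -
    have "m \<le> q * m" using assms by simp
    then show ?thesis using that dvd_imp_le[of m n] order_trans[of m "q * m" n]
      unfolding multiples_or_ge_def by blast
  qed
qed

lemma shift_multiples_or_ge:
  "(+) m ` multiples_or_ge m q = {n. m \<le> n \<and> (m dvd n \<or> q * m + m \<le> n)}"
proof
  show "{n. m \<le> n \<and> (m dvd n \<or> q * m + m \<le> n)} \<subseteq> (+) m ` multiples_or_ge m q"
  proof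
    fix n assume n: "n \<in> {n. m \<le> n \<and> (m dvd n \<or> q * m + m \<le> n)}"
    then have "n = m + (n - m)" "n - m \<in> multiples_or_ge m q"
      by (auto simp: multiples_or_ge_def)
    then show "n \<in> (+) m ` multiples_or_ge m q" by blast
  qed
qed (auto simp: multiples_or_ge_def)

lemma not_dvd_strictly_between:
  fixes m q n :: nat
  assumes "q * m < n" "n < q * m + m"
  shows "\<not> m dvd n"
proof
  assume "m dvd n"
  then obtain k where k: "n = m * k" by blast
  then have "q < k" "k < Suc q" using assms
    by (simp_all add: mult.commute[of _ m] add.commute flip: mult_Suc_right)
  then show False by simp
qed

lemma sg_type_multiples_or_ge:
  assumes m: "m \<ge> 2" and q: "q > 0"
  shows "sg_type TYPE('k::field) (multiples_or_ge m q) = m - 1"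
proof -
  let ?S = "multiples_or_ge m q"
  have "{a \<in> ?S. \<forall>s\<in>?S - {0}. a + s \<in> (+) m ` ?S} - (+) m ` ?S = {q * m<..<q * m + m}"
  proof (intro equalityI subsetI)
    fix a assume a: "a \<in> {a \<in> ?S. \<forall>s\<in>?S - {0}. a + s \<in> (+) m ` ?S} - (+) m ` ?S"
    \<comment> \<open>\<open>0\<close> lies outside the socle: \<open>s = qm + 1\<close> is in \<open>S\<close>, but \<open>qm + 1 - m\<close> is a gap.\<close>
    have "a \<noteq> 0"
    proof
      assume "a = 0"
      moreover have "q * m + 1 \<in> ?S - {0}" by (simp add: multiples_or_ge_def)
      ultimately have "q * m + 1 \<in> (+) m ` ?S" using a by auto
      moreover have "\<not> m dvd q * m + 1" using m by (intro not_dvd_strictly_between[of q]) auto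
      ultimately show False using m by (auto simp: shift_multiples_or_ge)
    qed
    moreover have "\<not> (m dvd a \<and> a \<noteq> 0)"
      using a dvd_imp_le[of m a] by (auto simp: shift_multiples_or_ge)
    moreover have "m dvd a \<or> q * m \<le> a" using a by (simp add: multiples_or_ge_def)
    ultimately have "\<not> m dvd a" "q * m \<le> a" by auto
    moreover have "m \<le> q * m" using q by simp
    then have "m \<le> a" using \<open>q * m \<le> a\<close> by (rule order_trans)
    then have "a < q * m + m" using a by (simp add: shift_multiples_or_ge)
    moreover have "a \<noteq> q * m" using \<open>\<not> m dvd a\<close> by auto
    ultimately show "a \<in> {q * m<..<q * m + m}" by simp
  next
    fix a assume a: "a \<in> {q * m<..<q * m + m}"
    then have "\<not> m dvd a" using not_dvd_strictly_between[of q m a] by auto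
    moreover have "a + s \<in> (+) m ` ?S" if "s \<in> ?S - {0}" for s
    proof -
      have "m \<le> q * m" using q by simp
      then have "m \<le> s" using that dvd_imp_le[of m s] order_trans[of m "q * m" s]
        unfolding multiples_or_ge_def by blast
      then show ?thesis using a by (auto simp: shift_multiples_or_ge)
    qed
    moreover have "a \<in> ?S" using a by (simp add: multiples_or_ge_def)
    moreover have "a \<notin> (+) m ` ?S"
      using a \<open>\<not> m dvd a\<close> by (simp add: shift_multiples_or_ge)
    ultimately show "a \<in> {a \<in> ?S. \<forall>s\<in>?S - {0}. a + s \<in> (+) m ` ?S} - (+) m ` ?S"
      by blast
  qed
  then show ?thesis
    using m q by (simp add: sg_type_eq_card numerical_semigroup_multiples_or_ge
      sg_multiplicity_multiples_or_ge)
qed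

lemma sg_reduced_type_multiples_or_ge:
  assumes m: "m \<ge> 2" and q: "q > 0"
  shows "sg_reduced_type TYPE('k::field) (multiples_or_ge m q) = m - 1"
proof -
  let ?S = "multiples_or_ge m q"
  \<comment> \<open>The conductor starts at \<open>qm\<close>, because \<open>qm - 1\<close> is a gap.\<close>
  have "{n. \<forall>i. n + i \<in> ?S} = {q * m..}"
  proof (intro equalityI subsetI)
    fix n assume n: "n \<in> {n. \<forall>i. n + i \<in> ?S}"
    show "n \<in> {q * m..}"
    proof (rule ccontr)
      assume "n \<notin> {q * m..}"
      then have "n + (q * m - 1 - n) = q * m - 1" by simp
      then have "q * m - 1 \<in> ?S" using n by (metis (lifting) mem_Collect_eq)
      moreover obtain k where k: "q = Suc k" using q by (cases q) auto
      moreover have "\<not> m dvd k * m + m - 1"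
        using m by (intro not_dvd_strictly_between[of k]) auto
      ultimately show False using m by (auto simp: multiples_or_ge_def add.commute)
    qed
  qed (auto simp: multiples_or_ge_def)
  then have "{n. \<forall>i. n + i \<in> ?S} - (+) m ` ?S = {q * m..} - (+) m ` ?S" by simp
  also have "\<dots> = {q * m<..<q * m + m}"
  proof -
    have "m \<le> q * m" using q by simp
    then have "n \<in> {q * m..} - (+) m ` ?S \<longleftrightarrow> q * m \<le> n \<and> \<not> m dvd n \<and> n < q * m + m" for n
      using order_trans[of m "q * m" n] unfolding shift_multiples_or_ge by auto
    moreover have "q * m \<le> n \<and> \<not> m dvd n \<and> n < q * m + m \<longleftrightarrow> n \<in> {q * m<..<q * m + m}" for n
      using not_dvd_strictly_between[of q m n] dvd_triv_right[of m q]
      unfolding greaterThanLessThan_iff order_less_le[of "q * m" n] by blast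
    ultimately show ?thesis by blast
  qed
  finally show ?thesis
    using m q by (simp add: sg_reduced_type_eq_card numerical_semigroup_multiples_or_ge
      sg_multiplicity_multiples_or_ge)
qed

lemma inj_multiples_or_ge:
  assumes m: "m \<ge> 2"
  shows "inj (multiples_or_ge m)"
proof -
  have le: "q \<le> p" if "multiples_or_ge m p = multiples_or_ge m q" for p q
  proof -
    have "p * m + 1 \<in> multiples_or_ge m p" by (simp add: multiples_or_ge_def)
    then have "p * m + 1 \<in> multiples_or_ge m q" using that by simp
    moreover have "\<not> m dvd p * m + 1" using m by (intro not_dvd_strictly_between[of p]) auto
    ultimately have "q * m < p * m + m" using m by (auto simp: multiples_or_ge_def)
    then have "q * m < Suc p * m" by simp
    then show ?thesis by (metis mult_less_cancel2 less_Suc_eq_le)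
  qed
  show ?thesis by (rule injI) (metis le le_antisym)
qed

theorem mainTheorem12:
  fixes r :: nat
  assumes "r > 0"
  shows "infinite {S. numerical_semigroup S \<and>
           sg_type TYPE('k::{alg_closed_field, field_char_0}) S = r \<and>
           maximal_reduced_type TYPE('k) S}"
proof (rule infinite_super)
  have "inj_on (multiples_or_ge (r + 1)) {0<..}"
    using assms by (intro inj_on_subset[OF inj_multiples_or_ge]) auto
  then show "infinite (multiples_or_ge (r + 1) ` {0<..})"
    by (simp add: finite_image_iff infinite_Ioi)
  show "multiples_or_ge (r + 1) ` {0<..} \<subseteq> {S. numerical_semigroup S \<and>
      sg_type TYPE('k) S = r \<and> maximal_reduced_type TYPE('k) S}"
    using assms by (auto simp: numerical_semigroup_multiples_or_ge maximal_reduced_type_def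
      sg_type_multiples_or_ge sg_reduced_type_multiples_or_ge)
qed

end
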